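(* Consider a polynomial unconstrained binary optimization problem in variables $x_1,\dots,x_n\in\{0,1\}$ to which global variable substitution (as defined in the context) is applied. Let $U$ be the set of all substitutions made, and for $i\in[n]$ let $U_i\subseteq U$ be the set of substitutions containing $x_i$. For $u_{\mathbf j}\in U$ let $|u_{\mathbf j}|$ be the number of variables that $u_{\mathbf j}$ replaces, and let $m_{u_{\mathbf j}}$ be the number of slack variables in the first constraint of $u_{\mathbf j}$. For a vertex $v$ of the derived graph let $\deg_s(v)$ be the number of edges incident to $v$ that are due to the substitution. Then: (1) for every slack variable $\delta$ belonging to the constraints of a substitution $u_{\mathbf j}\in U$, $$\deg_s(\delta)\in\{2,\ |u_{\mathbf j}|+m_{u_{\mathbf j}}\};$$ (2) for every $i\in[n]$, $$\deg_s(x_i)=\sum_{u_{\mathbf j}\in U_i}\bigl[|u_{\mathbf j}|+m_{u_{\mathbf j}}+1\bigr]-\sum_{p\in[n]\setminus\{i\}}z_{i,p}\bigl[|U_i\cap U_p|-1\bigr]+|C'_{x_i}|,$$ where $z_{i,p}=1$ if $U_i\cap U_p\neq\emptyset$ and $z_{i,p}=0$ otherwise, and $|C'_{x_i}|$ is the number of monomials (with more than two variables) containing $x_i$ into which no substitution containing $x_i$ is substituted; (3) for every $u_{\mathbf j}\in U$, $$\deg_s(u_{\mathbf j})=2|u_{\mathbf j}|+m_{u_{\mathbf j}}+|C_{u_{\mathbf j}}|,$$ where $|C_{u_{\mathbf j}}|$ is the number of monomials with more than two variables that use the substitution $u_{\mathbf j}$.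
   Context: Notation: $[n]=\{1,\dots,n\}$. The objective is a polynomial in the binary variables $x_1,\dots,x_n$. Since $x_i^2=x_i$, its monomials are products of distinct variables, and each monomial is identified with its set of variables (so monomials are counted as distinct sets). Substitution. For a list ${\mathbf j}=(j_1,\dots,j_s)$ of $s\ge 2$ distinct indices in $[n]$, a substitution $u_{\mathbf j}$ is a new binary variable standing for the product $x_{j_1}x_{j_2}\cdots x_{j_s}$. Write $|u_{\mathbf j}|=s$, and say that $u_{\mathbf j}$ contains $x_{j_1},\dots,x_{j_s}$. Different substitutions correspond to different sets of variables. Global variable substitution. Every monomial of the objective with more than two variables is rewritten as a product of exactly two factors, by partitioning its set of variables into two disjoint nonempty blocks. Each block with at least two variables is replaced by the corresponding substitution variable in $U$, which is then said to be substituted into, or used by, the monomial. A block consisting of a single variable $x_i$ is left as $x_i$. The same substitution variable may be used by several monomials. Monomials of the objective with at most two variables play no role in $\deg_s$. Constraints. For each $u_{\mathbf j}\in U$ the following constraints are imposed, with an integer $m_{u_{\mathbf j}}\in\{1,\dots,|u_{\mathbf j}|\}$: - one first constraint $$u_{\mathbf j}=\sum_{x_i\text{ contained in }u_{\mathbf j}}x_i-\sum_{k=1}^{m_{u_{\mathbf j}}}\delta_{{\mathbf j},k}-(|u_{\mathbf j}|-1);$$ - for each $x_i$ contained in $u_{\mathbf j}$, one constraint $$u_{\mathbf j}=x_i-\delta'_{{\mathbf j},i}.$$ All the variables $\delta_{{\mathbf j},k}$ and $\delta'_{{\mathbf j},i}$ are binary slack variables. They are pairwise distinct, both within the constraints of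 one substitution and across different substitutions. Dualization. Each constraint is dualized: all terms are moved to one side, the resulting expression is squared and expanded, and it is added to the objective as a penalty, with a common positive penalty factor. Derived graph. The derived graph is the simple graph with one vertex for each variable (all $x_i$, all $u_{\mathbf j}\in U$, all slack variables) and an edge between two distinct variables whenever they appear together in a monomial. The edges due to the substitution are those between two distinct variables that appear together either in a monomial of the expansion of one of the squared constraints, or as the two factors of a rewritten monomial (a monomial of the objective that originally had more than two variables). An edge arising in several of these ways is counted once. Two-variable monomials $x_ix_p$ present in the original objective are not counted in $\deg_s$, unless the same edge also arises from a squared constraint. *)

theory Defs
  imports Complex_Main "HOL-Library.Poly_Mapping" "HOL-Library.Disjoint_Sets"
begin

text \<open>
  A substitution is identified with the set \<open>S\<close> of indices of the variables whose product it
  replaces. \<open>Orig i\<close> is \<open>x\<^sub>i\<close>, \<open>Subst S\<close> is \<open>u\<^sub>S\<close>, \<open>Slack S k\<close> is the \<open>k\<close>-th slack variable of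
  the first constraint of \<open>u\<^sub>S\<close>, and \<open>Slack' S i\<close> is the slack variable of the constraint linking
  \<open>u\<^sub>S\<close> with \<open>x\<^sub>i\<close>. Slack variables of different constraints are distinct by construction.
\<close>

datatype var = Orig nat | Subst "nat set" | Slack "nat set" nat | Slack' "nat set" nat

text \<open>
  The objective, being reduced modulo \<open>x\<^sub>i\<^sup>2 = x\<^sub>i\<close>, maps each set \<open>M\<close> of indices to the coefficient
  of \<open>\<Prod>i\<in>M. x\<^sub>i\<close>; its monomials are \<open>keys f\<close>. Polynomials in all variables have type \<open>vpoly\<close>.
\<close>

type_synonym objective = "nat set \<Rightarrow>\<^sub>0 real"

type_synonym vpoly = "(var \<Rightarrow>\<^sub>0 nat) \<Rightarrow>\<^sub>0 real"

definition pvar :: "var \<Rightarrow> vpoly" where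
  "pvar v = Poly_Mapping.single (Poly_Mapping.single v 1) 1"

definition pconst :: "real \<Rightarrow> vpoly" where
  "pconst c = Poly_Mapping.single 0 c"

definition big_monomials :: "objective \<Rightarrow> nat set set" where
  "big_monomials f = {M \<in> Poly_Mapping.keys f. 2 < card M}"

text \<open>
  \<open>blocks M\<close> is the partition of \<open>M\<close> chosen in rewriting \<open>M\<close>; it matters only for
  \<open>M \<in> big_monomials f\<close>.
\<close>

definition used :: "(nat set \<Rightarrow> nat set set) \<Rightarrow> nat set \<Rightarrow> nat set set" where
  "used blocks M = {B \<in> blocks M. 2 \<le> card B}"

locale global_substitution =
  fixes n :: nat
    and f :: objective
    and blocks :: "nat set \<Rightarrow> nat set set"
    and U :: "nat set set"
    and m :: "nat set \<Rightarrow> nat"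
    and penalty :: real
  assumes objective_vars: "\<And>M. M \<in> Poly_Mapping.keys f \<Longrightarrow> M \<subseteq> {1..n}"
    and blocks_partition: "\<And>M. M \<in> big_monomials f \<Longrightarrow> partition_on M (blocks M)"
    and two_blocks: "\<And>M. M \<in> big_monomials f \<Longrightarrow> card (blocks M) = 2"
    and used_in_U: "\<And>M. M \<in> big_monomials f \<Longrightarrow> used blocks M \<subseteq> U"
    and U_vars: "\<And>S. S \<in> U \<Longrightarrow> S \<subseteq> {1..n}"
    and U_card: "\<And>S. S \<in> U \<Longrightarrow> 2 \<le> card S"
    and m_range: "\<And>S. S \<in> U \<Longrightarrow> m S \<in> {1..card S}"
    and penalty_pos: "0 < penalty"

definition block_factor :: "nat set \<Rightarrow> var" where
  "block_factor B = (if card B = 1 then Orig (the_elem B) else Subst B)"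

definition rewritten :: "(nat set \<Rightarrow> nat set set) \<Rightarrow> nat set \<Rightarrow> var set" where
  "rewritten blocks M = (if 2 < card M then block_factor ` blocks M else Orig ` M)"

text \<open>Each constraint is the polynomial \<open>lhs - rhs\<close> that is squared by the dualization.\<close>

definition first_constraint :: "(nat set \<Rightarrow> nat) \<Rightarrow> nat set \<Rightarrow> vpoly" where
  "first_constraint m S =
     pvar (Subst S)
     - ((\<Sum>i\<in>S. pvar (Orig i)) - (\<Sum>k=1..m S. pvar (Slack S k)) - pconst (real (card S) - 1))"

definition link_constraint :: "nat set \<Rightarrow> nat \<Rightarrow> vpoly" where
  "link_constraint S i = pvar (Subst S) - (pvar (Orig i) - pvar (Slack' S i))"

definition constraints :: "(nat set \<Rightarrow> nat) \<Rightarrow> nat set \<Rightarrow> vpoly set" where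
  "constraints m S = insert (first_constraint m S) (link_constraint S ` S)"

definition slacks :: "(nat set \<Rightarrow> nat) \<Rightarrow> nat set \<Rightarrow> var set" where
  "slacks m S = Slack S ` {1..m S} \<union> Slack' S ` S"

text \<open>The variable sets of the monomials of a polynomial.\<close>

definition mon_sets :: "vpoly \<Rightarrow> var set set" where
  "mon_sets p = Poly_Mapping.keys ` Poly_Mapping.keys p"

definition pairs :: "var set set \<Rightarrow> var set set" where
  "pairs T = {{v, w} | v w. v \<noteq> w \<and> (\<exists>t\<in>T. v \<in> t \<and> w \<in> t)}"

definition derived_vertices ::
  "nat \<Rightarrow> nat set set \<Rightarrow> (nat set \<Rightarrow> nat) \<Rightarrow> var set" where
  "derived_vertices n U m = Orig ` {1..n} \<union> Subst ` U \<union> (\<Union>S\<in>U. slacks m S)"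

text \<open>
  Monomials are collected from the rewritten objective and from each penalty term separately. In
  the sum of all of them, a quadratic monomial \<open>x\<^sub>i x\<^sub>p\<close> of the objective could cancel against the
  penalty terms for exceptional values of the penalty factor.
\<close>

definition derived_edges ::
  "objective \<Rightarrow> (nat set \<Rightarrow> nat set set) \<Rightarrow> nat set set \<Rightarrow> (nat set \<Rightarrow> nat) \<Rightarrow> real \<Rightarrow> var set set"
  where
  "derived_edges f blocks U m penalty =
     pairs (rewritten blocks ` Poly_Mapping.keys f
            \<union> (\<Union>S\<in>U. \<Union>c\<in>constraints m S. mon_sets (pconst penalty * c\<^sup>2)))"

definition subst_edges ::
  "objective \<Rightarrow> (nat set \<Rightarrow> nat set set) \<Rightarrow> nat set set \<Rightarrow> (nat set \<Rightarrow> nat) \<Rightarrow> var set set"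
  where
  "subst_edges f blocks U m =
     pairs (rewritten blocks ` big_monomials f
            \<union> (\<Union>S\<in>U. \<Union>c\<in>constraints m S. mon_sets (c\<^sup>2)))"

definition deg_s ::
  "nat \<Rightarrow> objective \<Rightarrow> (nat set \<Rightarrow> nat set set) \<Rightarrow> nat set set \<Rightarrow> (nat set \<Rightarrow> nat) \<Rightarrow> real
    \<Rightarrow> var \<Rightarrow> nat"
  where
  "deg_s n f blocks U m penalty v =
     card {e \<in> derived_edges f blocks U m penalty.
             e \<subseteq> derived_vertices n U m \<and> v \<in> e \<and> e \<in> subst_edges f blocks U m}"

definition substs_of :: "nat set set \<Rightarrow> nat \<Rightarrow> nat set set" where
  "substs_of U i = {S \<in> U. i \<in> S}"

definition share :: "nat set set \<Rightarrow> nat \<Rightarrow> nat \<Rightarrow> int" where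
  "share U i p = (if substs_of U i \<inter> substs_of U p \<noteq> {} then 1 else 0)"

definition C_var :: "objective \<Rightarrow> (nat set \<Rightarrow> nat set set) \<Rightarrow> nat \<Rightarrow> nat set set" where
  "C_var f blocks i = {M \<in> big_monomials f. i \<in> M \<and> (\<forall>S \<in> used blocks M. i \<notin> S)}"

definition C_subst :: "objective \<Rightarrow> (nat set \<Rightarrow> nat set set) \<Rightarrow> nat set \<Rightarrow> nat set set" where
  "C_subst f blocks S = {M \<in> big_monomials f. S \<in> used blocks M}"

end

theory Submission
  imports Defs
begin

text \<open>
  The square of an affine polynomial contains the product of two distinct variables exactly when
  both occur in the polynomial, because the coefficient of that product is twice the product of
  their coefficients. So each first constraint induces a complete graph on its variables and each
  link constraint a triangle. All degrees follow by listing the neighbours of each vertex; for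
  \<open>x\<^sub>i\<close>, an index \<open>p\<close> is met once for each substitution containing both \<open>x\<^sub>i\<close> and \<open>x\<^sub>p\<close>, which
  accounts for the correction term.
\<close>

section \<open>Squares of affine polynomials\<close>

abbreviation vmon :: "var \<Rightarrow> var \<Rightarrow>\<^sub>0 nat" where
  "vmon v \<equiv> Poly_Mapping.single v 1"

text \<open>For a polynomial of degree at most one these are all its variables. The constant term is
  left out, as it creates no edge.\<close>

definition affine_vars :: "vpoly \<Rightarrow> var set" where
  "affine_vars p = {v. vmon v \<in> Poly_Mapping.keys p}"

text \<open>Each of \<open>k\<close> and \<open>l\<close> carries at most one variable, so the
  exponents of \<open>v\<close> and \<open>w\<close> alone force one of them to carry
  \<open>v\<close> and the other \<open>w\<close>.\<close>

lemma vmon_add_eq_iff: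
  assumes "v \<noteq> w" "k \<in> insert 0 (range vmon)" "l \<in> insert 0 (range vmon)"
  shows "k + l = vmon v + vmon w \<longleftrightarrow> k = vmon v \<and> l = vmon w \<or> k = vmon w \<and> l = vmon v"
    (is "?L \<longleftrightarrow> ?R")
proof
  assume L: ?L
  have eq: "Poly_Mapping.lookup k x + Poly_Mapping.lookup l x = (1 when v = x) + (1 when w = x)" for x
    using arg_cong[OF L, of "\<lambda>q. Poly_Mapping.lookup q x"] by (simp add: lookup_add lookup_single)
  have *: "q = 0 \<or> (\<exists>x. q = vmon x)" if "q \<in> insert 0 (range vmon)" for q
    using that by auto
  show ?R
    using *[OF assms(2)] *[OF assms(3)] eq[of v] eq[of w] assms(1)
    by (auto simp: lookup_single when_def split: if_splits)
qed (auto simp: add.commute)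

text \<open>In the expanded square the product of \<open>v\<close> and \<open>w\<close> arises from
  exactly two ordered pairs of monomials of \<open>p\<close>, hence the factor 2.\<close>

lemma lookup_square_affine:
  fixes p :: vpoly
  assumes p: "Poly_Mapping.keys p \<subseteq> insert 0 (range vmon)" and "v \<noteq> w"
  shows "Poly_Mapping.lookup (p\<^sup>2) (vmon v + vmon w) =
    2 * Poly_Mapping.lookup p (vmon v) * Poly_Mapping.lookup p (vmon w)"
proof -
  let ?c = "Poly_Mapping.lookup p"
  \<comment> \<open>Adding both monomials, possibly with coefficient zero, lets the sums collapse
    whether or not \<open>v\<close> and \<open>w\<close> occur in \<open>p\<close>.\<close>
  let ?K = "insert (vmon v) (insert (vmon w) (Poly_Mapping.keys p))"
  have rep: "p = (\<Sum>k\<in>?K. Poly_Mapping.single k (?c k))"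
  proof (rule poly_mapping_eqI)
    fix x
    have "Poly_Mapping.lookup (\<Sum>k\<in>?K. Poly_Mapping.single k (?c k)) x
        = (\<Sum>k\<in>?K. if k = x then ?c k else 0)"
      by (simp only: lookup_sum lookup_single when_def)
    also have "\<dots> = (if x \<in> ?K then ?c x else 0)"
      by (simp only: sum.delta finite_insert finite_keys)
    also have "\<dots> = ?c x"
      by (auto simp: in_keys_iff)
    finally show "?c x = Poly_Mapping.lookup (\<Sum>k\<in>?K. Poly_Mapping.single k (?c k)) x"
      by simp
  qed
  have ne: "vmon v \<noteq> vmon w"
    using \<open>v \<noteq> w\<close> by (metis lookup_single_eq lookup_single_not_eq zero_neq_one)
  have "p\<^sup>2 = (\<Sum>k\<in>?K. \<Sum>l\<in>?K. Poly_Mapping.single (k + l) (?c k * ?c l))"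
    unfolding power2_eq_square by (subst (1 2) rep) (simp only: sum_product mult_single)
  then have "Poly_Mapping.lookup (p\<^sup>2) (vmon v + vmon w)
      = (\<Sum>k\<in>?K. \<Sum>l\<in>?K. (?c k * ?c l) when (k + l = vmon v + vmon w))"
    by (simp only: lookup_sum lookup_single)
  \<comment> \<open>The two ordered pairs exclude each other because \<open>vmon v\<close> and
    \<open>vmon w\<close> differ, so the indicator of their disjunction is a sum of two
    indicators.\<close>
  also have "\<dots> = (\<Sum>k\<in>?K. \<Sum>l\<in>?K.
      (if k = vmon v then if l = vmon w then ?c k * ?c l else 0 else 0)
      + (if k = vmon w then if l = vmon v then ?c k * ?c l else 0 else 0))"
  proof (intro sum.cong refl)
    fix k l assume "k \<in> ?K" "l \<in> ?K"
    then have kl: "k \<in> insert 0 (range vmon)" "l \<in> insert 0 (range vmon)"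
      using p by auto
    show "((?c k * ?c l) when (k + l = vmon v + vmon w)) =
      (if k = vmon v then if l = vmon w then ?c k * ?c l else 0 else 0)
      + (if k = vmon w then if l = vmon v then ?c k * ?c l else 0 else 0)"
      unfolding vmon_add_eq_iff[OF \<open>v \<noteq> w\<close> kl] using ne by (auto simp: when_def)
  qed
  also have "\<dots> = 2 * ?c (vmon v) * ?c (vmon w)"
  proof -
    have *: "(\<Sum>k\<in>?K. \<Sum>l\<in>?K. if k = a then if l = b then ?c k * ?c l else 0 else 0) = ?c a * ?c b"
      if "a \<in> ?K" "b \<in> ?K" for a b
    proof -
      have "(\<Sum>k\<in>?K. \<Sum>l\<in>?K. if k = a then if l = b then ?c k * ?c l else 0 else 0)
          = (\<Sum>k\<in>?K. if k = a then \<Sum>l\<in>?K. if l = b then ?c k * ?c l else 0 else 0)"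
        by (intro sum.cong) auto
      also have "\<dots> = ?c a * ?c b"
        using that by (simp only: sum.delta finite_insert finite_keys if_True)
      finally show ?thesis .
    qed
    show ?thesis
      unfolding sum.distrib using *[of "vmon v" "vmon w"] *[of "vmon w" "vmon v"] by simp
  qed
  finally show ?thesis .
qed

text \<open>Every monomial of the square is a product of two monomials of \<open>p\<close>, so
  squaring brings in no new variables. Conversely, twice a product of nonzero reals is nonzero, so
  the product of \<open>v\<close> and \<open>w\<close> cannot cancel.\<close>

lemma mon_sets_square_affine:
  assumes p: "Poly_Mapping.keys p \<subseteq> insert 0 (range vmon)" and "v \<noteq> w"
  shows "(\<exists>t\<in>mon_sets (p\<^sup>2). v \<in> t \<and> w \<in> t) \<longleftrightarrow> v \<in> affine_vars p \<and> w \<in> affine_vars p"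
proof
  assume "\<exists>t\<in>mon_sets (p\<^sup>2). v \<in> t \<and> w \<in> t"
  then obtain k where k: "k \<in> Poly_Mapping.keys (p\<^sup>2)"
      "v \<in> Poly_Mapping.keys k" "w \<in> Poly_Mapping.keys k"
    by (auto simp: mon_sets_def)
  then obtain a b where ab: "k = a + b" "a \<in> Poly_Mapping.keys p" "b \<in> Poly_Mapping.keys p"
    using keys_mult[of p p] by (auto simp: power2_eq_square)
  have "x \<in> affine_vars p" if "x \<in> Poly_Mapping.keys k" for x
  proof -
    have "x \<in> Poly_Mapping.keys a \<or> x \<in> Poly_Mapping.keys b"
      using that keys_add[of a b] ab(1) by auto
    then show ?thesis
      using ab(2,3) p by (auto simp: affine_vars_def split: if_splits)
  qed
  then show "v \<in> affine_vars p \<and> w \<in> affine_vars p"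
    using k by blast
next
  assume "v \<in> affine_vars p \<and> w \<in> affine_vars p"
  then have "Poly_Mapping.lookup (p\<^sup>2) (vmon v + vmon w) \<noteq> 0"
    unfolding lookup_square_affine[OF assms] by (auto simp: affine_vars_def in_keys_iff)
  then have "Poly_Mapping.keys (vmon v + vmon w) \<in> mon_sets (p\<^sup>2)"
    by (auto simp: mon_sets_def in_keys_iff)
  moreover have "v \<in> Poly_Mapping.keys (vmon v + vmon w)" "w \<in> Poly_Mapping.keys (vmon v + vmon w)"
    by (auto simp: in_keys_iff lookup_add lookup_single)
  ultimately show "\<exists>t\<in>mon_sets (p\<^sup>2). v \<in> t \<and> w \<in> t"
    by blast
qed

text \<open>Scaling never adds monomials. Applied to \<open>c\<close> and then to its inverse
  \<open>1 / c\<close>, this gives both inclusions.\<close>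

lemma keys_pconst_mult:
  assumes "c \<noteq> 0"
  shows "Poly_Mapping.keys (pconst c * p) = Poly_Mapping.keys p"
proof
  have sub: "Poly_Mapping.keys (pconst c * p) \<subseteq> Poly_Mapping.keys p" for c p
    using keys_mult[of "pconst c" p] by (auto simp: pconst_def split: if_splits)
  have "pconst (1 / c) * (pconst c * p) = p"
    using assms by (simp add: pconst_def mult_single single_one flip: mult.assoc)
  then show "Poly_Mapping.keys p \<subseteq> Poly_Mapping.keys (pconst c * p)"
    using sub[of "1 / c" "pconst c * p"] by simp
  show "Poly_Mapping.keys (pconst c * p) \<subseteq> Poly_Mapping.keys p"
    by (rule sub)
qed

lemma mon_sets_pconst_mult: "c \<noteq> 0 \<Longrightarrow> mon_sets (pconst c * p) = mon_sets p"
  by (simp add: mon_sets_def keys_pconst_mult)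

section \<open>The constraints\<close>

text \<open>The vertex set of the clique created by the squared first constraint;
  \<open>link_vars\<close> plays the same role for the link constraints.\<close>

definition first_vars :: "(nat set \<Rightarrow> nat) \<Rightarrow> nat set \<Rightarrow> var set" where
  "first_vars m S = insert (Subst S) (Orig ` S \<union> Slack S ` {1..m S})"

definition link_vars :: "nat set \<Rightarrow> nat \<Rightarrow> var set" where
  "link_vars S i = {Subst S, Orig i, Slack' S i}"

lemma in_first_vars_iff [simp]:
  "Orig i \<in> first_vars m S \<longleftrightarrow> i \<in> S"
  "Subst T \<in> first_vars m S \<longleftrightarrow> T = S"
  "Slack T k \<in> first_vars m S \<longleftrightarrow> T = S \<and> k \<in> {1..m S}"
  "Slack' T i \<notin> first_vars m S"
  by (auto simp: first_vars_def)

lemma in_link_vars_iff [simp]: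
  "Orig j \<in> link_vars S i \<longleftrightarrow> j = i"
  "Subst T \<in> link_vars S i \<longleftrightarrow> T = S"
  "Slack T k \<notin> link_vars S i"
  "Slack' T j \<in> link_vars S i \<longleftrightarrow> T = S \<and> j = i"
  by (auto simp: link_vars_def)

lemma lookup_pvar_vmon: "Poly_Mapping.lookup (pvar v) (vmon w) = (if v = w then 1 else 0)"
  by (auto simp: pvar_def lookup_single when_def dest: arg_cong[of _ _ Poly_Mapping.keys])

lemma lookup_pconst_vmon: "Poly_Mapping.lookup (pconst c) (vmon w) = 0"
  by (auto simp: pconst_def lookup_single when_def dest: arg_cong[of _ _ Poly_Mapping.keys])

lemma keys_diff_affine:
  fixes p q :: vpoly
  assumes "Poly_Mapping.keys p \<subseteq> A" "Poly_Mapping.keys q \<subseteq> A"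
  shows "Poly_Mapping.keys (p - q) \<subseteq> A"
  using keys_diff[of p q] assms by blast

lemma keys_sum_affine:
  fixes p :: "'a \<Rightarrow> vpoly"
  assumes "\<And>i. i \<in> I \<Longrightarrow> Poly_Mapping.keys (p i) \<subseteq> A"
  shows "Poly_Mapping.keys (\<Sum>i\<in>I. p i) \<subseteq> A"
  using keys_sum[of p I] assms by blast

lemma keys_pvar: "Poly_Mapping.keys (pvar v) \<subseteq> insert 0 (range vmon)"
  by (auto simp: pvar_def)

lemma keys_pconst: "Poly_Mapping.keys (pconst c) \<subseteq> insert 0 (range vmon)"
  by (auto simp: pconst_def)

lemma first_constraint_affine:
  "Poly_Mapping.keys (first_constraint m S) \<subseteq> insert 0 (range vmon)"
  unfolding first_constraint_def
  by (intro keys_diff_affine keys_sum_affine keys_pvar keys_pconst)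

lemma link_constraint_affine:
  "Poly_Mapping.keys (link_constraint S i) \<subseteq> insert 0 (range vmon)"
  unfolding link_constraint_def by (intro keys_diff_affine keys_pvar)

text \<open>The summands of the constraint involve pairwise distinct variables, so nothing cancels
  and every coefficient is 1 or -1.\<close>

lemma affine_vars_first_constraint:
  assumes "finite S"
  shows "affine_vars (first_constraint m S) = first_vars m S"
proof (rule set_eqI)
  fix v
  have slack: "(\<Sum>k=1..m S. if S = T \<and> k = j then 1 else 0 :: real)
      = (if S = T \<and> j \<in> {1..m S} then 1 else 0)" for T j
    by (cases "S = T") auto
  show "v \<in> affine_vars (first_constraint m S) \<longleftrightarrow> v \<in> first_vars m S"
    by (cases v)
      (use assms in \<open>auto simp: affine_vars_def first_constraint_def first_vars_def in_keys_iff
        lookup_minus lookup_sum lookup_pvar_vmon[unfolded One_nat_def]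
        lookup_pconst_vmon[unfolded One_nat_def] slack[unfolded One_nat_def]\<close>)
qed

lemma affine_vars_link_constraint: "affine_vars (link_constraint S i) = link_vars S i"
  by (auto simp: affine_vars_def link_constraint_def link_vars_def in_keys_iff
    lookup_minus lookup_pvar_vmon[unfolded One_nat_def] split: if_splits)

lemma doubleton_in_pairs: "{v, w} \<in> pairs T \<longleftrightarrow> v \<noteq> w \<and> (\<exists>t\<in>T. v \<in> t \<and> w \<in> t)"
  by (auto simp: pairs_def doubleton_eq_iff)

section \<open>Factors of rewritten monomials\<close>

lemma block_factor_eq_Orig_iff:
  assumes "B \<noteq> {}"
  shows "block_factor B = Orig i \<longleftrightarrow> B = {i}"
  using assms by (auto simp: block_factor_def card_1_singleton_iff)

text \<open>\<open>block_factor\<close> also sends sets of cardinality 0 to substitution variables.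
  The assumptions exclude these, which leaves cardinality at least 2.\<close>

lemma block_factor_eq_Subst_iff:
  assumes "B \<noteq> {}" "finite B"
  shows "block_factor B = Subst S \<longleftrightarrow> B = S \<and> 2 \<le> card B"
proof -
  have "card B \<noteq> 0" using assms by simp
  then show ?thesis by (auto simp: block_factor_def)
qed

section \<open>Neighbourhoods in the derived graph\<close>

context global_substitution
begin

lemma finite_U: "finite U"
  by (rule finite_subset[of _ "Pow {1..n}"]) (use U_vars in auto)

lemma finite_member_U: "S \<in> U \<Longrightarrow> finite S"
  using U_vars finite_subset by blast

lemma finite_big_monomials: "finite (big_monomials f)"
  by (simp add: big_monomials_def)

lemma big_monomialD:
  assumes "M \<in> big_monomials f"
  shows "finite M" "2 < card M" "M \<subseteq> {1..n}"
  using assms objective_vars finite_subset[of M "{1..n}"] by (auto simp: big_monomials_def)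

text \<open>There are only two blocks, so one of them determines the other as its complement in
  \<open>M\<close>.\<close>

lemma block_complement:
  assumes M: "M \<in> big_monomials f" and A: "A \<in> blocks M"
  shows "blocks M = {A, M - A}" "A \<noteq> {}" "M - A \<noteq> {}" "A \<subseteq> M"
proof -
  obtain X Y where XY: "blocks M = {X, Y}" "X \<noteq> Y"
    using two_blocks[OF M] by (auto simp: card_2_iff)
  have part: "X \<union> Y = M" "X \<inter> Y = {}" "X \<noteq> {}" "Y \<noteq> {}"
    using blocks_partition[OF M] XY unfolding partition_on_def by (auto simp: disjoint_def)
  show "blocks M = {A, M - A}" "A \<noteq> {}" "M - A \<noteq> {}" "A \<subseteq> M"
    using XY part A by auto
qed

lemma finite_block: "M \<in> big_monomials f \<Longrightarrow> A \<in> blocks M \<Longrightarrow> finite A"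
  using block_complement(4) big_monomialD(1) finite_subset by blast

text \<open>A block is a singleton inside \<open>{1..n}\<close> or has at least two elements and is
  then in \<open>U\<close>. In particular, no slack variable occurs in a rewritten monomial.\<close>

lemma block_factor_vertex:
  assumes M: "M \<in> big_monomials f" and A: "A \<in> blocks M"
  shows "block_factor A \<in> Orig ` {1..n} \<union> Subst ` U"
proof (cases "card A = 1")
  case True
  then show ?thesis
    using block_complement(4)[OF M A] big_monomialD(3)[OF M]
    by (auto simp: block_factor_def card_1_singleton_iff)
next
  case False
  moreover have "card A \<noteq> 0"
    using block_complement(2)[OF M A] finite_block[OF M A] by simp
  ultimately have "A \<in> used blocks M"
    using A by (auto simp: used_def)
  then show ?thesis
    using used_in_U[OF M] False by (auto simp: block_factor_def)
qed

lemma rewritten_big: "M \<in> big_monomials f \<Longrightarrow> rewritten blocks M = block_factor ` blocks M"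
  using big_monomialD(2) by (simp add: rewritten_def)

lemma Orig_in_rewritten_iff:
  assumes M: "M \<in> big_monomials f"
  shows "Orig i \<in> rewritten blocks M \<longleftrightarrow> {i} \<in> blocks M"
proof -
  have "Orig i = block_factor A \<longleftrightarrow> A = {i}" if "A \<in> blocks M" for A
    using block_factor_eq_Orig_iff[OF block_complement(2)[OF M that]] by metis
  then show ?thesis
    unfolding rewritten_big[OF M] by (auto simp: image_iff)
qed

lemma Subst_in_rewritten_iff:
  assumes M: "M \<in> big_monomials f"
  shows "Subst S \<in> rewritten blocks M \<longleftrightarrow> S \<in> used blocks M"
proof -
  have "Subst S = block_factor A \<longleftrightarrow> A = S \<and> 2 \<le> card A" if "A \<in> blocks M" for A
    using block_factor_eq_Subst_iff[OF block_complement(2)[OF M that] finite_block[OF M that]]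
    by metis
  then show ?thesis
    unfolding rewritten_big[OF M] used_def by (auto simp: image_iff)
qed

text \<open>The block that holds \<open>i\<close> is either the singleton or a used substitution
  containing \<open>i\<close>; the other block never contains \<open>i\<close>. So these are the
  monomials in which \<open>Orig i\<close> survives as a factor.\<close>

lemma C_var_iff: "M \<in> C_var f blocks i \<longleftrightarrow> M \<in> big_monomials f \<and> {i} \<in> blocks M"
proof (cases "M \<in> big_monomials f")
  case M: True
  show ?thesis
  proof
    assume C: "M \<in> C_var f blocks i"
    then have "i \<in> M" by (simp add: C_var_def)
    then obtain A where A: "A \<in> blocks M" "i \<in> A"
      using blocks_partition[OF M] by (auto simp: partition_on_def)
    have "\<not> 2 \<le> card A"
      using C A by (auto simp: C_var_def used_def)
    moreover have "card A \<noteq> 0"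
      using A finite_block[OF M A(1)] by auto
    ultimately have "card A = 1" by linarith
    then have "A = {i}"
      using A(2) by (auto simp: card_1_singleton_iff)
    then show "M \<in> big_monomials f \<and> {i} \<in> blocks M"
      using A(1) M by simp
  next
    assume "M \<in> big_monomials f \<and> {i} \<in> blocks M"
    then have "blocks M = {{i}, M - {i}}" "i \<in> M"
      using block_complement[OF M, of "{i}"] by auto
    then show "M \<in> C_var f blocks i"
      using M by (auto simp: C_var_def used_def)
  qed
qed (simp add: C_var_def)

text \<open>The first disjunct collects the edges from dualization, the second those from rewriting.
  Both carry \<open>w \<noteq> v\<close> so that each can be evaluated on its own.\<close>

definition adj :: "var \<Rightarrow> var \<Rightarrow> bool" where
  "adj v w \<longleftrightarrow>
     w \<noteq> v \<and> (\<exists>S\<in>U. v \<in> first_vars m S \<and> w \<in> first_vars m S \<or>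
       (\<exists>i\<in>S. v \<in> link_vars S i \<and> w \<in> link_vars S i)) \<or>
     w \<noteq> v \<and> (\<exists>M\<in>big_monomials f. v \<in> rewritten blocks M \<and> w \<in> rewritten blocks M)"

text \<open>By the analysis of squares, each squared constraint contributes the complete graph on
  its variables.\<close>

lemma subst_edges_iff_adj: "{v, w} \<in> subst_edges f blocks U m \<longleftrightarrow> adj v w"
proof (cases "v = w")
  case True
  then show ?thesis
    by (simp only: subst_edges_def doubleton_in_pairs adj_def) simp
next
  case False
  have first: "(\<exists>t\<in>mon_sets ((first_constraint m S)\<^sup>2). v \<in> t \<and> w \<in> t)
      \<longleftrightarrow> v \<in> first_vars m S \<and> w \<in> first_vars m S" if "S \<in> U" for S
    using mon_sets_square_affine[OF first_constraint_affine False]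
      affine_vars_first_constraint[OF finite_member_U[OF that]] by simp
  have link: "(\<exists>t\<in>mon_sets ((link_constraint S i)\<^sup>2). v \<in> t \<and> w \<in> t)
      \<longleftrightarrow> v \<in> link_vars S i \<and> w \<in> link_vars S i" for S i
    using mon_sets_square_affine[OF link_constraint_affine False]
      affine_vars_link_constraint by simp
  have "(\<exists>t\<in>(\<Union>c\<in>constraints m S. mon_sets (c\<^sup>2)). v \<in> t \<and> w \<in> t) \<longleftrightarrow>
      v \<in> first_vars m S \<and> w \<in> first_vars m S
      \<or> (\<exists>i\<in>S. v \<in> link_vars S i \<and> w \<in> link_vars S i)" if "S \<in> U" for S
    unfolding constraints_def first[OF that, symmetric] link[symmetric] by blast
  then have "(\<exists>S\<in>U. \<exists>t\<in>(\<Union>c\<in>constraints m S. mon_sets (c\<^sup>2)). v \<in> t \<and> w \<in> t) \<longleftrightarrow>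
      (\<exists>S\<in>U. v \<in> first_vars m S \<and> w \<in> first_vars m S
        \<or> (\<exists>i\<in>S. v \<in> link_vars S i \<and> w \<in> link_vars S i))"
    by (rule bex_cong[OF refl])
  then show ?thesis
    using False unfolding subst_edges_def doubleton_in_pairs adj_def bex_Un bex_UN by auto
qed

text \<open>A positive penalty factor is nonzero, so it leaves the monomials of each squared
  constraint unchanged.\<close>

lemma subst_edges_subset_derived: "subst_edges f blocks U m \<subseteq> derived_edges f blocks U m penalty"
proof -
  have mono: "pairs T \<subseteq> pairs T'" if "T \<subseteq> T'" for T T'
    using that unfolding pairs_def by blast
  have big: "big_monomials f \<subseteq> Poly_Mapping.keys f"
    by (auto simp: big_monomials_def)
  have eq: "mon_sets (pconst penalty * p) = mon_sets p" for p
    using penalty_pos by (simp add: mon_sets_pconst_mult)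
  show ?thesis
    unfolding subst_edges_def derived_edges_def eq by (intro mono Un_mono image_mono big order_refl)
qed

text \<open>With the symmetry of \<open>adj\<close>, this makes the vertex condition in
  \<open>deg_s\<close> automatic.\<close>

lemma adj_derived_vertex:
  assumes "adj v w"
  shows "v \<in> derived_vertices n U m"
proof -
  consider M where "M \<in> big_monomials f" "v \<in> rewritten blocks M"
    | S where "S \<in> U" "v \<in> first_vars m S"
    | S i where "S \<in> U" "i \<in> S" "v \<in> link_vars S i"
    using assms unfolding adj_def by blast
  then show ?thesis
  proof cases
    case 1
    then show ?thesis
      using block_factor_vertex by (auto simp: rewritten_big derived_vertices_def)
  next
    case 2
    then show ?thesis
      using U_vars[of S] by (auto simp: first_vars_def derived_vertices_def slacks_def)
  next
    case 3
    then show ?thesis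
      using U_vars[of S] by (auto simp: link_vars_def derived_vertices_def slacks_def)
  qed
qed

lemma adj_sym: "adj v w \<Longrightarrow> adj w v"
  unfolding adj_def by blast

text \<open>In a simple graph the edges at \<open>v\<close> correspond bijectively to its
  neighbours, so each degree is found by listing neighbours.\<close>

lemma deg_s_eq_card_adj: "deg_s n f blocks U m penalty v = card {w. adj v w}"
proof -
  have "{e \<in> derived_edges f blocks U m penalty.
      e \<subseteq> derived_vertices n U m \<and> v \<in> e \<and> e \<in> subst_edges f blocks U m}
      = (\<lambda>w. {v, w}) ` {w. adj v w}" (is "?E = _")
  proof
    show "?E \<subseteq> (\<lambda>w. {v, w}) ` {w. adj v w}"
    proof
      fix e assume e: "e \<in> ?E"
      then obtain a b where "e = {a, b}" "v = a \<or> v = b"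
        by (auto simp: subst_edges_def pairs_def)
      then obtain w where "e = {v, w}" by auto
      then show "e \<in> (\<lambda>w. {v, w}) ` {w. adj v w}"
        using e subst_edges_iff_adj by auto
    qed
    show "(\<lambda>w. {v, w}) ` {w. adj v w} \<subseteq> ?E"
      using subst_edges_iff_adj subst_edges_subset_derived adj_derived_vertex adj_sym by blast
  qed
  moreover have "inj_on (\<lambda>w. {v, w}) {w. adj v w}"
    by (auto simp: inj_on_def doubleton_eq_iff)
  ultimately show ?thesis
    unfolding deg_s_def by (simp add: card_image)
qed

section \<open>Degrees of the slack variables\<close>

lemma slack_notin_rewritten:
  assumes "M \<in> big_monomials f"
  shows "Slack S k \<notin> rewritten blocks M" "Slack' S k \<notin> rewritten blocks M"
  unfolding rewritten_big[OF assms] using block_factor_vertex[OF assms] by force+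

text \<open>A slack variable lies in one constraint only and in no rewritten monomial, so its
  neighbours are the other variables of that constraint.\<close>

lemma adj_Slack:
  assumes "S \<in> U" "k \<in> {1..m S}"
  shows "{w. adj (Slack S k) w} = first_vars m S - {Slack S k}"
proof (rule set_eqI)
  fix w
  show "w \<in> {w. adj (Slack S k) w} \<longleftrightarrow> w \<in> first_vars m S - {Slack S k}"
    using assms slack_notin_rewritten by (cases w) (auto simp: adj_def)
qed

lemma adj_Slack':
  assumes "S \<in> U" "i \<in> S"
  shows "{w. adj (Slack' S i) w} = {Subst S, Orig i}"
proof (rule set_eqI)
  fix w
  show "w \<in> {w. adj (Slack' S i) w} \<longleftrightarrow> w \<in> {Subst S, Orig i}"
    using assms slack_notin_rewritten by (cases w) (auto simp: adj_def)
qed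

lemma card_first_vars:
  assumes "finite S"
  shows "card (first_vars m S) = Suc (card S + m S)"
proof -
  have "card (Orig ` S \<union> Slack S ` {1..m S}) = card S + m S"
    using assms by (subst card_Un_disjoint) (auto simp: card_image inj_on_def)
  moreover have "Subst S \<notin> Orig ` S \<union> Slack S ` {1..m S}"
    by auto
  ultimately show ?thesis
    using assms by (simp add: first_vars_def)
qed

text \<open>The clique of the first constraint has \<open>card S + m S + 1\<close> vertices and that
  of a link constraint has 3; the slack variable itself is not counted.\<close>

lemma deg_s_slack:
  assumes S: "S \<in> U" and d: "d \<in> slacks m S"
  shows "deg_s n f blocks U m penalty d \<in> {2, card S + m S}"
proof -
  consider k where "k \<in> {1..m S}" "d = Slack S k" | i where "i \<in> S" "d = Slack' S i"
    using d by (auto simp: slacks_def)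
  then show ?thesis
  proof cases
    case 1
    then have "d \<in> first_vars m S" by (auto simp: first_vars_def)
    then show ?thesis
      unfolding deg_s_eq_card_adj using adj_Slack[OF S 1(1)] 1(2) card_first_vars[OF finite_member_U[OF S]]
      by (simp add: card_Diff_singleton)
  next
    case 2
    then show ?thesis
      unfolding deg_s_eq_card_adj using adj_Slack'[OF S 2(1)] by simp
  qed
qed

section \<open>Degrees of the substitution variables\<close>

lemma inj_on_block_factor:
  assumes "\<And>A. A \<in> F \<Longrightarrow> A \<noteq> {} \<and> finite A"
  shows "inj_on block_factor F"
proof (rule inj_onI)
  fix A B assume A: "A \<in> F" and B: "B \<in> F" and eq: "block_factor A = block_factor B"
  show "A = B"
  proof (cases "card A = 1")
    case True
    then obtain i where "A = {i}" by (auto simp: card_1_singleton_iff)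
    then show ?thesis
      using eq block_factor_eq_Orig_iff assms[OF A] assms[OF B] by metis
  next
    case False
    then have "block_factor A = Subst A" by (simp add: block_factor_def)
    then show ?thesis
      using eq block_factor_eq_Subst_iff assms[OF B] by metis
  qed
qed

lemma adj_Subst:
  assumes S: "S \<in> U"
  shows "{w. adj (Subst S) w} =
    Orig ` S \<union> Slack S ` {1..m S} \<union> Slack' S ` S \<union> (\<lambda>M. block_factor (M - S)) ` C_subst f blocks S"
proof -
  have rw: "w \<noteq> Subst S \<and> w \<in> rewritten blocks M \<longleftrightarrow> w = block_factor (M - S)"
    if M: "M \<in> big_monomials f" and u: "S \<in> used blocks M" for M w
  proof -
    have "S \<in> blocks M" "2 \<le> card S" using u by (auto simp: used_def)
    note bc = block_complement[OF M this(1)]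
    have "block_factor S = Subst S"
      using \<open>2 \<le> card S\<close> by (simp add: block_factor_def)
    \<comment> \<open>Equality would force \<open>M - S = S\<close>, which is impossible for
      nonempty \<open>S\<close>.\<close>
    moreover have "block_factor (M - S) \<noteq> Subst S"
      using block_factor_eq_Subst_iff[OF bc(3)] big_monomialD(1)[OF M] bc(2) by auto
    ultimately show ?thesis
      unfolding rewritten_big[OF M] bc(1) by auto
  qed
  have rewriting: "(w \<noteq> Subst S \<and> (\<exists>M\<in>big_monomials f. Subst S \<in> rewritten blocks M \<and> w \<in> rewritten blocks M))
      \<longleftrightarrow> w \<in> (\<lambda>M. block_factor (M - S)) ` C_subst f blocks S" for w
    using rw Subst_in_rewritten_iff unfolding C_subst_def by blast
  have dualization: "(w \<noteq> Subst S \<and> (\<exists>T\<in>U. Subst S \<in> first_vars m T \<and> w \<in> first_vars m T \<or>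
        (\<exists>i\<in>T. Subst S \<in> link_vars T i \<and> w \<in> link_vars T i)))
      \<longleftrightarrow> w \<in> Orig ` S \<union> Slack S ` {1..m S} \<union> Slack' S ` S" for w
    using S by (cases w) auto
  show ?thesis
    unfolding adj_def dualization rewriting Collect_disj_eq Collect_mem_eq by (rule refl)
qed

text \<open>Dualization gives \<open>card S\<close> original variables, \<open>card S\<close> link
  slacks and \<open>m S\<close> further slacks. Each monomial using the substitution adds one more
  neighbour, its other factor.\<close>

lemma deg_s_Subst:
  assumes S: "S \<in> U"
  shows "deg_s n f blocks U m penalty (Subst S) = 2 * card S + m S + card (C_subst f blocks S)"
proof -
  let ?C = "C_subst f blocks S"
  let ?R = "(\<lambda>M. block_factor (M - S)) ` ?C"
  have finS: "finite S" by (rule finite_member_U[OF S])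
  have C: "M \<in> big_monomials f" "S \<in> blocks M" if "M \<in> ?C" for M
    using that by (auto simp: C_subst_def used_def)
  have finC: "finite ?C"
    using finite_big_monomials by (simp add: C_subst_def)
  \<comment> \<open>Since \<open>S\<close> is contained in \<open>M\<close>, the monomial is
    recovered as the union of \<open>S\<close> and \<open>M - S\<close>.\<close>
  have "inj_on (\<lambda>M. M - S) ?C"
    using C block_complement(4) by (intro inj_onI) (metis Diff_partition)
  moreover have "inj_on block_factor ((\<lambda>M. M - S) ` ?C)"
    using C block_complement(3) big_monomialD(1) by (intro inj_on_block_factor) auto
  ultimately have cardR: "card ?R = card ?C"
    using card_image[OF comp_inj_on] by (simp add: comp_def)
  \<comment> \<open>The other factor is built from a block disjoint from \<open>S\<close>, so it is
    not an original variable already counted through dualization.\<close>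
  have "Orig p \<notin> ?R" if "p \<in> S" for p
  proof
    assume "Orig p \<in> ?R"
    then obtain M where M: "M \<in> ?C" "block_factor (M - S) = Orig p" by auto
    then have "M - S = {p}"
      using block_factor_eq_Orig_iff[OF block_complement(3)[OF C[OF M(1)]]] by simp
    then show False using that by auto
  qed
  moreover have "?R \<subseteq> Orig ` {1..n} \<union> Subst ` U"
  proof -
    have "M - S \<in> blocks M" if "M \<in> ?C" for M
      using block_complement(1)[OF C[OF that]] by auto
    then show ?thesis
      using block_factor_vertex C(1) by blast
  qed
  ultimately have disj: "(Orig ` S \<union> Slack S ` {1..m S} \<union> Slack' S ` S) \<inter> ?R = {}"
    by blast
  have "card (Orig ` S \<union> Slack S ` {1..m S} \<union> Slack' S ` S) = 2 * card S + m S"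
    using finS by (subst card_Un_disjoint, auto)+ (simp add: card_image inj_on_def)
  then show ?thesis
    unfolding deg_s_eq_card_adj adj_Subst[OF S]
    using card_Un_disjoint[OF _ _ disj] finS finC cardR by simp
qed

section \<open>Degrees of the original variables\<close>

lemma adj_Orig:
  "{w. adj (Orig i) w} =
    Orig ` (\<Union>(substs_of U i) - {i}) \<union> Subst ` substs_of U i
    \<union> (\<Union>S\<in>substs_of U i. insert (Slack' S i) (Slack S ` {1..m S}))
    \<union> (\<lambda>M. Subst (M - {i})) ` C_var f blocks i"
proof -
  have rw: "w \<noteq> Orig i \<and> w \<in> rewritten blocks M \<longleftrightarrow> w = Subst (M - {i})"
    if M: "M \<in> big_monomials f" and i: "{i} \<in> blocks M" for M w
  proof -
    note bc = block_complement[OF M i]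
    \<comment> \<open>As \<open>M\<close> has more than two elements, the block complementary to
      \<open>{i}\<close> is always replaced by a substitution.\<close>
    have "card (M - {i}) \<noteq> 1"
      using big_monomialD(2)[OF M] by (auto simp: card_Diff_singleton_if)
    then show ?thesis
      unfolding rewritten_big[OF M] bc(1) by (auto simp: block_factor_def)
  qed
  have rewriting: "(w \<noteq> Orig i \<and> (\<exists>M\<in>big_monomials f. Orig i \<in> rewritten blocks M \<and> w \<in> rewritten blocks M))
      \<longleftrightarrow> w \<in> (\<lambda>M. Subst (M - {i})) ` C_var f blocks i" for w
    using rw Orig_in_rewritten_iff C_var_iff by blast
  \<comment> \<open>Among the link constraints of \<open>T\<close>, only the one for
    \<open>i\<close> itself involves \<open>Orig i\<close>; it adds just \<open>Slack' T i\<close>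
    to the neighbours from the first constraint.\<close>
  have dualization: "(w \<noteq> Orig i \<and> (\<exists>T\<in>U. Orig i \<in> first_vars m T \<and> w \<in> first_vars m T \<or>
        (\<exists>j\<in>T. Orig i \<in> link_vars T j \<and> w \<in> link_vars T j)))
      \<longleftrightarrow> w \<in> Orig ` (\<Union>(substs_of U i) - {i}) \<union> Subst ` substs_of U i
    \<union> (\<Union>S\<in>substs_of U i. insert (Slack' S i) (Slack S ` {1..m S}))" for w
    by (cases w) (auto simp: substs_of_def)
  show ?thesis
    unfolding adj_def dualization rewriting Collect_disj_eq Collect_mem_eq by (rule refl)
qed

text \<open>Double counting of the pairs \<open>(S, p)\<close> with \<open>p \<noteq> i\<close> and
  both indices in \<open>S\<close>: summing over \<open>S\<close> gives \<open>card S - 1\<close>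
  each, summing over \<open>p\<close> gives the number of shared substitutions. The correction
  removes all but one of the counts of each \<open>p\<close>.\<close>

lemma card_common_neighbours:
  "int (card (\<Union>(substs_of U i) - {i})) = (\<Sum>S\<in>substs_of U i. int (card S) - 1)
    - (\<Sum>p\<in>{1..n} - {i}. share U i p * (int (card (substs_of U i \<inter> substs_of U p)) - 1))"
proof -
  let ?V = "substs_of U i"
  let ?P = "{1..n} - {i}"
  have finV: "finite ?V" using finite_U by (simp add: substs_of_def)
  have V: "finite S" "i \<in> S" "S \<subseteq> {1..n}" if "S \<in> ?V" for S
    using that finite_member_U U_vars by (auto simp: substs_of_def)
  have "(\<Sum>S\<in>?V. int (card S) - 1) = (\<Sum>S\<in>?V. \<Sum>p\<in>?P. if p \<in> S then 1 else 0)"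
  proof (rule sum.cong[OF refl])
    fix S assume S: "S \<in> ?V"
    have "?P \<inter> S = S - {i}" using V[OF S] by auto
    moreover have "0 < card S" using V[OF S] card_gt_0_iff by blast
    ultimately show "int (card S) - 1 = (\<Sum>p\<in>?P. if p \<in> S then 1 else 0)"
      using V[OF S] by (simp add: card_Diff_singleton sum.If_cases)
  qed
  also have "\<dots> = (\<Sum>p\<in>?P. \<Sum>S\<in>?V. if p \<in> S then 1 else 0)"
    by (rule sum.swap)
  also have "\<dots> = (\<Sum>p\<in>?P. int (card (?V \<inter> substs_of U p)))"
  proof (rule sum.cong[OF refl])
    fix p
    have "?V \<inter> {S. p \<in> S} = ?V \<inter> substs_of U p" by (auto simp: substs_of_def)
    then show "(\<Sum>S\<in>?V. if p \<in> S then 1 else 0) = int (card (?V \<inter> substs_of U p))"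
      using finV by (simp add: sum.If_cases)
  qed
  finally have 1: "(\<Sum>S\<in>?V. int (card S) - 1) = (\<Sum>p\<in>?P. int (card (?V \<inter> substs_of U p)))" .
  have "?P \<inter> {p. ?V \<inter> substs_of U p \<noteq> {}} = \<Union>?V - {i}"
    using U_vars unfolding substs_of_def by blast
  then have 2: "int (card (\<Union>?V - {i})) = (\<Sum>p\<in>?P. share U i p)"
    by (simp add: share_def sum.If_cases)
  \<comment> \<open>Termwise: with no shared substitution all terms vanish, and otherwise
    \<open>share U i p\<close> is 1 and a count \<open>a\<close> becomes
    \<open>a - (a - 1) = 1\<close>.\<close>
  have "(\<Sum>p\<in>?P. int (card (?V \<inter> substs_of U p)))
      - (\<Sum>p\<in>?P. share U i p * (int (card (?V \<inter> substs_of U p)) - 1)) = (\<Sum>p\<in>?P. share U i p)"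
    unfolding sum_subtractf[symmetric] by (rule sum.cong) (auto simp: share_def)
  then show ?thesis using 1 2 by simp
qed

text \<open>The neighbours split into original variables, substitutions containing \<open>i\<close>,
  slacks, and the factors paired with \<open>Orig i\<close> in rewritten monomials. These four sets
  are disjoint and are counted separately.\<close>

lemma deg_s_Orig:
  "int (deg_s n f blocks U m penalty (Orig i)) =
     (\<Sum>S\<in>substs_of U i. int (card S) + int (m S) + 1)
     - (\<Sum>p\<in>{1..n} - {i}. share U i p * (int (card (substs_of U i \<inter> substs_of U p)) - 1))
     + int (card (C_var f blocks i))"
proof -
  let ?V = "substs_of U i"
  let ?C = "C_var f blocks i"
  let ?O = "Orig ` (\<Union>?V - {i})"
  let ?S = "Subst ` ?V"
  let ?L = "\<Union>S\<in>?V. insert (Slack' S i) (Slack S ` {1..m S})"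
  let ?R = "(\<lambda>M. Subst (M - {i})) ` ?C"
  have finV: "finite ?V" using finite_U by (simp add: substs_of_def)
  have finO: "finite (\<Union>?V)"
    using finV finite_member_U by (auto simp: substs_of_def)
  have finC: "finite ?C" using finite_big_monomials by (simp add: C_var_def)
  have "inj_on (\<lambda>M. Subst (M - {i})) ?C"
    by (intro inj_onI) (auto simp: C_var_def)
  then have R: "card ?R = card ?C" by (rule card_image)
  have O: "card ?O = card (\<Union>?V - {i})" and S: "card ?S = card ?V"
    by (simp_all add: card_image inj_on_def)
  \<comment> \<open>Different substitutions have disjoint slacks; each contributes
    \<open>m S\<close> slacks of its first constraint and one link slack.\<close>
  have "card ?L = (\<Sum>S\<in>?V. card (insert (Slack' S i) (Slack S ` {1..m S})))"
    using finV by (intro card_UN_disjoint) auto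
  also have "\<dots> = (\<Sum>S\<in>?V. Suc (m S))"
    by (intro sum.cong refl) (subst card_insert_disjoint, auto simp: card_image inj_on_def)
  finally have L: "card ?L = (\<Sum>S\<in>?V. Suc (m S))" .
  \<comment> \<open>The substitutions in \<open>?R\<close> stand for sets \<open>M - {i}\<close>
    without \<open>i\<close>, while those in \<open>?S\<close> contain \<open>i\<close>.\<close>
  have "card (?O \<union> ?S \<union> ?L \<union> ?R) = card (?O \<union> ?S \<union> ?L) + card ?R"
    using finO finV finC by (intro card_Un_disjoint) (auto simp: substs_of_def)
  also have "card (?O \<union> ?S \<union> ?L) = card (?O \<union> ?S) + card ?L"
    using finO finV by (intro card_Un_disjoint) auto
  also have "card (?O \<union> ?S) = card ?O + card ?S"
    using finO finV by (intro card_Un_disjoint) auto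
  finally have deg: "int (deg_s n f blocks U m penalty (Orig i)) =
      int (card (\<Union>?V - {i})) + int (card ?V) + (\<Sum>S\<in>?V. int (m S) + 1) + int (card ?C)"
    unfolding deg_s_eq_card_adj adj_Orig O S L R by (simp add: add.commute)
  \<comment> \<open>Per substitution: \<open>card S - 1\<close> original variables before
    correction, the substitution itself, and \<open>m S + 1\<close> slacks.\<close>
  have "(\<Sum>S\<in>?V. int (card S) - 1) + int (card ?V) + (\<Sum>S\<in>?V. int (m S) + 1)
      = (\<Sum>S\<in>?V. int (card S) + int (m S) + 1)"
    by (simp add: sum.distrib sum_subtractf)
  then show ?thesis
    using deg card_common_neighbours[of i] by linarith
qed

end

theorem theorem2:
  fixes n :: nat
    and f :: objective
    and blocks :: "nat set \<Rightarrow> nat set set"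
    and U :: "nat set set"
    and m :: "nat set \<Rightarrow> nat"
    and penalty :: real
  assumes "global_substitution n f blocks U m penalty"
  shows "(\<forall>S\<in>U. \<forall>d\<in>slacks m S.
            deg_s n f blocks U m penalty d \<in> {2, card S + m S})
    \<and> (\<forall>i\<in>{1..n}.
         int (deg_s n f blocks U m penalty (Orig i)) =
           (\<Sum>S\<in>substs_of U i. int (card S) + int (m S) + 1)
           - (\<Sum>p\<in>{1..n} - {i}. share U i p * (int (card (substs_of U i \<inter> substs_of U p)) - 1))
           + int (card (C_var f blocks i)))
    \<and> (\<forall>S\<in>U.
         deg_s n f blocks U m penalty (Subst S) = 2 * card S + m S + card (C_subst f blocks S))"
proof -
  interpret global_substitution n f blocks U m penalty
    by (rule assms)
  show ?thesis
    by (intro conjI ballI deg_s_slack deg_s_Orig deg_s_Subst)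
qed

end
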